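(* Let $d\ge 1$ and $m$ be positive integers and let $C=[0,m]^d\subset\mathbb{R}^d$. Then the minimum cardinality of a maximal system of cubic islands in $C$ is $g'_d(m)=m$.
   Context: A brick of $C$ is a set $[a_1,b_1]\times\cdots\times[a_d,b_d]$ with $a_i,b_i\in\mathbb{Z}$ and $0\le a_i<b_i\le m$. A system of brick islands in $C$ is a set $H$ of bricks of $C$ such that any two members are either nested (one contains the other) or disjoint. A system of cubic islands in $C$ is a system of brick islands in $C$ all of whose members are cubes (all side lengths equal). Let $I_C$ denote the set of systems of cubic islands in $C$ and $Max(I_C)$ its maximal elements with respect to inclusion. Define $g'_d(m)=\min\{|H|:H\in Max(I_C)\}$. *)

theory Defs
  imports "HOL-Analysis.Analysis"
begin

text \<open>The dimension \<open>d \<ge> 1\<close> is \<open>CARD('d)\<close>, and \<open>cbox a b\<close> in \<open>real ^ 'd\<close> is the closed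
  product of the intervals from \<open>a $ i\<close> to \<open>b $ i\<close>. Islands are closed point sets,
  so two bricks sharing only a boundary point are not disjoint.\<close>

definition bricks :: "nat \<Rightarrow> (real ^ 'd) set set" where
  "bricks m = {cbox a b |a b. \<forall>i. a $ i \<in> \<int> \<and> b $ i \<in> \<int> \<and>
     0 \<le> a $ i \<and> a $ i < b $ i \<and> b $ i \<le> real m}"

definition brick_island_systems :: "nat \<Rightarrow> (real ^ 'd) set set set" where
  "brick_island_systems m =
     {H. H \<subseteq> bricks m \<and> (\<forall>A\<in>H. \<forall>B\<in>H. A \<subseteq> B \<or> B \<subseteq> A \<or> A \<inter> B = {})}"

definition is_cube :: "(real ^ 'd) set \<Rightarrow> bool" where
  "is_cube B \<longleftrightarrow> B \<noteq> {} \<and> (\<exists>a b. B = cbox a b \<and> (\<forall>i j. b $ i - a $ i = b $ j - a $ j))"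

definition cubic_island_systems :: "nat \<Rightarrow> (real ^ 'd) set set set" where
  "cubic_island_systems m = {H \<in> brick_island_systems m. \<forall>B\<in>H. is_cube B}"

definition maximal_cubic_island_systems :: "nat \<Rightarrow> (real ^ 'd) set set set" where
  "maximal_cubic_island_systems m =
     {H \<in> cubic_island_systems m. \<forall>H' \<in> cubic_island_systems m. H \<subseteq> H' \<longrightarrow> H' = H}"

definition min_maximal_cubic :: "'d::finite itself \<Rightarrow> nat \<Rightarrow> nat" where
  "min_maximal_cubic _ m = Min (card ` (maximal_cubic_island_systems m :: (real ^ 'd) set set set))"

text \<open>The following facts ensure that the minimum is taken over a finite nonempty set
  and that \<open>card\<close> is applied to finite sets only.\<close>

lemma finite_bricks: "finite (bricks m :: (real ^ 'd) set set)"
proof -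
  let ?G = "of_int ` {0..int m} :: real set"
  let ?V = "vec_lambda ` (PiE UNIV (\<lambda>_. ?G)) :: (real ^ 'd) set"
  have "finite ?V"
    by (intro finite_imageI finite_PiE) auto
  have "(bricks m :: (real ^ 'd) set set) \<subseteq> (\<lambda>(a, b). cbox a b) ` (?V \<times> ?V)"
  proof
    fix B :: "(real ^ 'd) set" assume "B \<in> bricks m"
    then obtain a b where B: "B = cbox a b"
      and ab: "\<And>i. a $ i \<in> \<int> \<and> b $ i \<in> \<int> \<and> 0 \<le> a $ i \<and> a $ i < b $ i \<and> b $ i \<le> real m"
      unfolding bricks_def by blast
    have G: "x \<in> ?G" if "x \<in> \<int>" "0 \<le> x" "x \<le> real m" for x :: real
      using that by (auto elim!: Ints_cases)
    have V: "v \<in> ?V" if "\<And>i. v $ i \<in> ?G" for v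
      using that by (intro image_eqI[of _ _ "vec_nth v"]) auto
    have "a $ i \<in> ?G" "b $ i \<in> ?G" for i
      using ab[of i] by (intro G; force)+
    then have "a \<in> ?V" "b \<in> ?V"
      by (simp_all only: V)
    then show "B \<in> (\<lambda>(a, b). cbox a b) ` (?V \<times> ?V)"
      using B by auto
  qed
  then show ?thesis
    using \<open>finite ?V\<close> by (meson finite_SigmaI finite_imageI finite_subset)
qed

lemma finite_cubic_island_systems:
  "finite (cubic_island_systems m :: (real ^ 'd) set set set)"
  by (rule finite_subset[of _ "Pow (bricks m)"])
    (auto simp: cubic_island_systems_def brick_island_systems_def finite_bricks)

lemma finite_cubic_island_system:
  "H \<in> cubic_island_systems m \<Longrightarrow> finite H"
  by (auto simp: cubic_island_systems_def brick_island_systems_def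
      intro: finite_subset[OF _ finite_bricks])

lemma finite_maximal_cubic_island_systems:
  "finite (maximal_cubic_island_systems m :: (real ^ 'd) set set set)"
  by (rule finite_subset[OF _ finite_cubic_island_systems])
    (auto simp: maximal_cubic_island_systems_def)

lemma maximal_cubic_island_systems_nonempty:
  "(maximal_cubic_island_systems m :: (real ^ 'd) set set set) \<noteq> {}"
proof -
  have "{} \<in> (cubic_island_systems m :: (real ^ 'd) set set set)"
    by (simp add: cubic_island_systems_def brick_island_systems_def)
  then obtain H where "H \<in> (cubic_island_systems m :: (real ^ 'd) set set set)"
    "\<forall>H' \<in> cubic_island_systems m. H \<subseteq> H' \<longrightarrow> H = H'"
    using finite_has_maximal[OF finite_cubic_island_systems, of m] by blast
  then show ?thesis
    by (auto simp: maximal_cubic_island_systems_def)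
qed

end

theory Submission
  imports Defs
begin

text \<open>The cubes \<open>[0,k]\<^sup>d\<close> for \<open>1 \<le> k \<le> m\<close> form a maximal system: a cube whose lower corner \<open>a\<close>
  has largest coordinate \<open>M > 0\<close> crosses \<open>[0,M]\<^sup>d\<close>.

  Conversely, let \<open>H\<close> be maximal and let \<open>Q \<in> H\<close> have lower corner \<open>a\<close> and side \<open>s\<close>. For each
  \<open>e\<close> with \<open>1 \<le> e < s\<close>, the cube of side \<open>e\<close> at \<open>a\<close> either belongs to \<open>H\<close> or crosses a member
  of \<open>H\<close>, so it is contained in or crossed by a maximal member \<open>P\<close> of \<open>H\<close> below \<open>Q\<close>. A cube \<open>P\<close>
  of side \<open>t\<close> accounts for at most \<open>t\<close> values of \<open>e\<close>. Hence the sides of the maximal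
  members below \<open>Q\<close> sum up to at least \<open>s - 1\<close>, and induction on \<open>s\<close> shows that at least \<open>s\<close>
  members of \<open>H\<close> are contained in \<open>Q\<close>.\<close>

section \<open>Cubes given by an integer corner and side, with containment and intersection as
  integer inequalities\<close>

definition cube :: "('d \<Rightarrow> int) \<Rightarrow> int \<Rightarrow> (real ^ 'd) set" where
  "cube a s = cbox (\<chi> i. of_int (a i)) (\<chi> i. of_int (a i + s))"

lemma mem_cube:
  "x \<in> cube a s \<longleftrightarrow> (\<forall>i. of_int (a i) \<le> x $ i \<and> x $ i \<le> of_int (a i + s))"
  by (simp add: cube_def mem_box_cart)

lemma cube_nonempty: "0 \<le> s \<Longrightarrow> cube a s \<noteq> {}"
proof -
  assume "0 \<le> s"
  then have "(\<chi> i. of_int (a i)) \<in> cube a s"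
    by (simp add: mem_cube)
  then show ?thesis by blast
qed

lemma cube_subset_iff:
  assumes "0 \<le> s"
  shows "cube a s \<subseteq> cube b t \<longleftrightarrow> (\<forall>i. b i \<le> a i \<and> a i + s \<le> b i + t)"
proof
  assume sub: "cube a s \<subseteq> cube b t"
  have "(\<chi> i. of_int (a i)) \<in> cube a s" "(\<chi> i. of_int (a i + s)) \<in> cube a s"
    using assms by (simp_all add: mem_cube)
  then have "(\<chi> i. of_int (a i)) \<in> cube b t" "(\<chi> i. of_int (a i + s)) \<in> cube b t"
    using sub by blast+
  then show "\<forall>i. b i \<le> a i \<and> a i + s \<le> b i + t"
    unfolding mem_cube vec_lambda_beta of_int_le_iff by blast
next
  assume le: "\<forall>i. b i \<le> a i \<and> a i + s \<le> b i + t"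
  show "cube a s \<subseteq> cube b t"
  proof
    fix x :: "real ^ 'a" assume x: "x \<in> cube a s"
    have "of_int (b i) \<le> x $ i \<and> x $ i \<le> of_int (b i + t)" for i
    proof -
      have "of_int (a i) \<le> x $ i" "x $ i \<le> of_int (a i + s)"
        using x by (auto simp: mem_cube)
      moreover have "of_int (b i) \<le> (of_int (a i) :: real)"
        "of_int (a i + s) \<le> (of_int (b i + t) :: real)"
        using le unfolding of_int_le_iff by blast+
      ultimately show ?thesis by linarith
    qed
    then show "x \<in> cube b t" by (simp add: mem_cube)
  qed
qed

text \<open>If the intervals meet in every coordinate, the coordinatewise maximum of the lower
  corners is a common point. The inequalities are weak because cubes that merely touch already
  meet.\<close>

lemma cube_disjoint_iff:
  assumes "0 \<le> s" "0 \<le> t"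
  shows "cube a s \<inter> cube b t = {} \<longleftrightarrow> \<not> (\<forall>i. a i \<le> b i + t \<and> b i \<le> a i + s)"
proof -
  have "\<exists>x. x \<in> cube a s \<inter> cube b t" if "\<forall>i. a i \<le> b i + t \<and> b i \<le> a i + s"
  proof
    have "a i \<le> max (a i) (b i) \<and> max (a i) (b i) \<le> a i + s \<and>
        b i \<le> max (a i) (b i) \<and> max (a i) (b i) \<le> b i + t" for i
      using that[rule_format, of i] assms by auto
    then show "(\<chi> i. of_int (max (a i) (b i))) \<in> cube a s \<inter> cube b t"
      unfolding Int_iff mem_cube vec_lambda_beta of_int_le_iff by blast
  qed
  moreover have "a i \<le> b i + t \<and> b i \<le> a i + s" if "x \<in> cube a s" "x \<in> cube b t" for x i
  proof -
    have "of_int (a i) \<le> (of_int (b i + t) :: real)" "of_int (b i) \<le> (of_int (a i + s) :: real)"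
      using that by (meson mem_cube order_trans)+
    then show ?thesis unfolding of_int_le_iff by blast
  qed
  ultimately show ?thesis by blast
qed

text \<open>Equal sides would force equal corners. This is the decrease needed for strong induction
  on the side.\<close>

lemma cube_psubset_side_less:
  assumes "cube a s \<subset> cube b t" "0 \<le> s"
  shows "s < t"
proof -
  have le: "\<And>i. b i \<le> a i \<and> a i + s \<le> b i + t"
    using assms cube_subset_iff[of s a b t] by blast
  have "s \<noteq> t"
  proof
    assume "s = t"
    then have "a = b" using le by (intro ext) (smt (verit))
    then show False using assms \<open>s = t\<close> by simp
  qed
  moreover have "s \<le> t" using le[of undefined] by linarith
  ultimately show ?thesis by simp
qed

section \<open>Cubic bricks and maximality in integer terms\<close>

definition cubic_bricks :: "nat \<Rightarrow> (real ^ 'd) set set" where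
  "cubic_bricks m = {cube a s |a s. 0 < s \<and> (\<forall>i. 0 \<le> a i \<and> a i + s \<le> int m)}"

lemma cubic_bricks_eq: "cubic_bricks m = {B \<in> bricks m. is_cube B}"
proof (intro set_eqI iffI)
  fix B :: "(real ^ 'd) set" assume "B \<in> cubic_bricks m"
  then obtain a s where B: "B = cube a s" "0 < s" "\<And>i. 0 \<le> a i \<and> a i + s \<le> int m"
    unfolding cubic_bricks_def by blast
  have upper: "real_of_int (a i + s) \<le> real m" for i
    using B(3)[of i] by (metis of_int_le_iff of_int_of_nat_eq)
  have "B \<in> bricks m"
    unfolding bricks_def B(1) cube_def mem_Collect_eq
    by (intro exI conjI, rule refl) (use B(2,3) upper in simp)
  moreover have "is_cube B"
    unfolding is_cube_def
  proof
    show "B \<noteq> {}" using B cube_nonempty[of s a] by simp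
    show "\<exists>a b. B = cbox a b \<and> (\<forall>i j. b $ i - a $ i = b $ j - a $ j)"
      unfolding B(1) cube_def by (intro exI conjI, rule refl) simp
  qed
  ultimately show "B \<in> {B \<in> bricks m. is_cube B}" by simp
next
  fix B :: "(real ^ 'd) set" assume "B \<in> {B \<in> bricks m. is_cube B}"
  then obtain u v u' v' where B: "B = cbox u v" "B = cbox u' v'" "B \<noteq> {}"
    and uv: "\<And>i. u $ i \<in> \<int> \<and> v $ i \<in> \<int> \<and> 0 \<le> u $ i \<and> u $ i < v $ i \<and> v $ i \<le> real m"
    and eq: "\<And>i j. v' $ i - u' $ i = v' $ j - u' $ j"
    unfolding bricks_def is_cube_def by blast
  \<comment> \<open>\<open>bricks\<close> and \<open>is_cube\<close> each supply their own corners;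
    a nonempty box determines its corners, so the equal-side condition holds for the integral
    ones.\<close>
  have "u' = u" "v' = v"
    using B eq_cbox[of u v u' v'] by auto
  define a where "a = (\<lambda>i. \<lfloor>u $ i\<rfloor>)"
  \<comment> \<open>\<open>undefined\<close> stands for an arbitrary coordinate; all side lengths
    agree.\<close>
  define s where "s = \<lfloor>v $ undefined - u $ undefined\<rfloor>"
  have a: "of_int (a i) = u $ i" for i
    using uv[of i] by (simp add: a_def)
  have s: "of_int s = v $ i - u $ i" for i
  proof -
    have "v $ undefined - u $ undefined \<in> \<int>" using uv[of undefined] by (intro Ints_diff) auto
    then have "of_int s = v $ undefined - u $ undefined" by (simp add: s_def)
    then show ?thesis using eq[of undefined i] \<open>u' = u\<close> \<open>v' = v\<close> by simp
  qed
  have "B = cube a s"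
  proof -
    have "real_of_int (a i + s) = v $ i" for i
      using a[of i] s[of i] by simp
    then show ?thesis by (simp add: B(1) cube_def a del: of_int_add)
  qed
  moreover have "0 < s"
    using s[of undefined] uv[of undefined] by linarith
  moreover have "0 \<le> a i \<and> a i + s \<le> int m" for i
    using a[of i] s[of i] uv[of i] by linarith
  ultimately show "B \<in> cubic_bricks m"
    unfolding cubic_bricks_def by blast
qed

text \<open>Two sets cross, in the sense of the overview, when this fails.\<close>

definition compatible :: "'a set \<Rightarrow> 'a set \<Rightarrow> bool" where
  "compatible A B \<longleftrightarrow> A \<subseteq> B \<or> B \<subseteq> A \<or> A \<inter> B = {}"

lemma cubic_island_systems_iff:
  "H \<in> cubic_island_systems m \<longleftrightarrow> H \<subseteq> cubic_bricks m \<and> (\<forall>A\<in>H. \<forall>B\<in>H. compatible A B)"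
  unfolding cubic_island_systems_def brick_island_systems_def cubic_bricks_eq compatible_def
  by blast

text \<open>Each member of a larger system is compatible with all of \<open>H\<close>, and adding
  one compatible cube to \<open>H\<close> again gives a system. So it suffices to test maximality on
  single cubes.\<close>

lemma maximal_cubic_island_systems_iff:
  "H \<in> maximal_cubic_island_systems m \<longleftrightarrow> H \<in> cubic_island_systems m \<and>
     (\<forall>B\<in>cubic_bricks m. (\<forall>A\<in>H. compatible A B) \<longrightarrow> B \<in> H)"
proof -
  have "insert B H \<in> cubic_island_systems m"
    if "H \<in> cubic_island_systems m" "B \<in> cubic_bricks m" "\<forall>A\<in>H. compatible A B" for B
    using that unfolding cubic_island_systems_iff compatible_def by blast
  then show ?thesis
    unfolding maximal_cubic_island_systems_def mem_Collect_eq
    by (smt (verit) cubic_island_systems_iff insertCI subset_antisym subset_eq)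
qed

section \<open>Upper bound: a maximal chain with \<open>m\<close> members\<close>

lemma cube_chain_maximal:
  "(\<lambda>k. cube (\<lambda>_. 0) (int k)) ` {1..m} \<in> (maximal_cubic_island_systems m :: (real ^ 'd) set set set)"
    (is "?H \<in> _")
  unfolding maximal_cubic_island_systems_iff cubic_island_systems_iff
proof (intro conjI ballI impI)
  show "?H \<subseteq> cubic_bricks m"
    unfolding cubic_bricks_def by force
next
  fix A B assume "A \<in> ?H" "B \<in> ?H"
  then obtain k l where "A = cube (\<lambda>_. 0) (int k)" "B = cube (\<lambda>_. 0) (int l)"
    by blast
  then show "compatible A B"
    using linear[of k l] by (simp add: compatible_def cube_subset_iff disj_assoc[symmetric])
next
  fix B :: "(real ^ 'd) set"
  assume "B \<in> cubic_bricks m" and compat: "\<forall>A\<in>?H. compatible A B"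
  then obtain a s where B: "B = cube a s" "0 < s" "\<And>i. 0 \<le> a i \<and> a i + s \<le> int m"
    unfolding cubic_bricks_def by blast
  define M where "M = Max (range a)"
  have M: "a i \<le> M" for i by (simp add: M_def)
  have "M \<in> range a" unfolding M_def by (rule Max_in) auto
  then obtain j where j: "a j = M" by auto
  have "M = 0"
  proof (rule ccontr)
    assume "M \<noteq> 0"
    then have "0 < M" using B(3)[of j] j by simp
    then have "nat M \<in> {1..m}" using B(2) B(3)[of j] j by auto
    then have "compatible (cube (\<lambda>_. 0) (int (nat M))) B" using compat by blast
    then have "compatible (cube (\<lambda>_. 0) M) (cube a s)" using \<open>0 < M\<close> B by simp
    \<comment> \<open>Coordinate \<open>j\<close> excludes both inclusions: there the first cube
      spans 0 to \<open>M\<close> and the second \<open>M\<close> to \<open>M + s\<close>. They meet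
      since the corner \<open>a\<close> lies in both.\<close>
    moreover have "\<not> cube (\<lambda>_. 0) M \<subseteq> cube a s"
      using \<open>0 < M\<close> j by (auto simp: cube_subset_iff intro!: exI[of _ j])
    moreover have "\<not> cube a s \<subseteq> cube (\<lambda>_. 0) M"
      using B(2) j by (auto simp: cube_subset_iff intro!: exI[of _ j])
    moreover have "cube (\<lambda>_. 0) M \<inter> cube a s \<noteq> {}"
      using B M \<open>0 < M\<close> by (simp add: cube_disjoint_iff add_nonneg_nonneg)
    ultimately show False unfolding compatible_def by blast
  qed
  then have "a = (\<lambda>_. 0)" using M B(3) by (metis order_antisym)
  then have "B = cube (\<lambda>_. 0) (int (nat s))" "nat s \<in> {1..m}"
    using B(1,2) B(3)[of j] by auto
  then show "B \<in> ?H" by blast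
qed

lemma card_cube_chain: "card ((\<lambda>k. cube (\<lambda>_. 0) (int k) :: (real ^ 'd) set) ` {1..m}) = m"
proof -
  have "inj_on (\<lambda>k. cube (\<lambda>_. 0) (int k) :: (real ^ 'd) set) {1..m}"
  proof (rule inj_onI)
    fix k l assume "(cube (\<lambda>_. 0) (int k) :: (real ^ 'd) set) = cube (\<lambda>_. 0) (int l)"
    then have "(cube (\<lambda>_. 0) (int k) :: (real ^ 'd) set) \<subseteq> cube (\<lambda>_. 0) (int l)"
      "(cube (\<lambda>_. 0) (int l) :: (real ^ 'd) set) \<subseteq> cube (\<lambda>_. 0) (int k)" by simp_all
    then show "k = l" by (simp add: cube_subset_iff)
  qed
  then show ?thesis by (simp add: card_image)
qed

section \<open>Lower bound: counting members below a given cube\<close>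

text \<open>Stated for every member of \<open>H\<close>, not only the full cube, so that the
  induction hypothesis applies to the maximal members strictly below
  \<open>cube a s\<close>.\<close>

lemma side_le_card_below:
  fixes a :: "'d::finite \<Rightarrow> int"
  assumes H: "H \<in> maximal_cubic_island_systems m"
    and Q: "cube a s \<in> H" "0 < s"
  shows "s \<le> int (card {X \<in> H. X \<subseteq> cube a s})"
  using Q
proof (induction "nat s" arbitrary: a s rule: less_induct)
  case less
  let ?Q = "cube a s"
  have sys: "H \<subseteq> cubic_bricks m" "\<And>A B. A \<in> H \<Longrightarrow> B \<in> H \<Longrightarrow> compatible A B"
    and max: "\<And>B. B \<in> cubic_bricks m \<Longrightarrow> (\<And>A. A \<in> H \<Longrightarrow> compatible A B) \<Longrightarrow> B \<in> H"
    and "finite H"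
    using H finite_cubic_island_system
    unfolding maximal_cubic_island_systems_iff cubic_island_systems_iff by blast+
  have "\<forall>X\<in>H. \<exists>b t. X = cube b t \<and> 0 < t \<and> (\<forall>i. 0 \<le> b i \<and> b i + t \<le> int m)"
    using sys(1) unfolding cubic_bricks_def by blast
  then obtain lo side where cube: "\<And>X. X \<in> H \<Longrightarrow> X = cube (lo X) (side X)"
    and side: "\<And>X. X \<in> H \<Longrightarrow> 0 < side X"
    and bounds: "\<And>X i. X \<in> H \<Longrightarrow> 0 \<le> lo X i \<and> lo X i + side X \<le> int m"
    by metis
  have subset_iff: "X \<subseteq> cube b t \<longleftrightarrow> (\<forall>i. b i \<le> lo X i \<and> lo X i + side X \<le> b i + t)"
    if "X \<in> H" for X b t
    using cube_subset_iff[of "side X" "lo X" b t] cube[OF that] side[OF that] by simp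
  have nonempty: "X \<noteq> {}" if "X \<in> H" for X
    using cube[OF that] side[OF that] cube_nonempty[of "side X" "lo X"] by simp
  have Q_bounds: "0 \<le> a i \<and> a i + s \<le> int m" for i
  proof -
    have "lo ?Q i \<le> a i \<and> a i + s \<le> lo ?Q i + side ?Q"
      using cube_subset_iff[of s a "lo ?Q" "side ?Q"] cube[OF less.prems(1)] less.prems(2) by simp
    then show ?thesis using bounds[OF less.prems(1), of i] by linarith
  qed

  define D where "D = {X \<in> H. X \<subset> ?Q}"
  define T where "T = {P \<in> D. \<forall>X\<in>D. P \<subseteq> X \<longrightarrow> X = P}"
  have "finite D" "finite T" using \<open>finite H\<close> by (simp_all add: D_def T_def)
  have top: "\<exists>P\<in>T. X \<subseteq> P" if "X \<in> D" for X
  proof -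
    obtain P where "P \<in> D" "X \<subseteq> P" "\<forall>Y\<in>D. P \<subseteq> Y \<longrightarrow> P = Y"
      using finite_has_maximal2[OF \<open>finite D\<close> \<open>X \<in> D\<close>] by blast
    then have "P \<in> T" by (simp add: T_def eq_commute)
    then show ?thesis using \<open>X \<subseteq> P\<close> by blast
  qed
  have T_H: "P \<in> H" and T_Q: "P \<subset> ?Q" if "P \<in> T" for P
    using that by (auto simp: T_def D_def)

  \<comment> \<open>For \<open>P\<close> inside \<open>?Q\<close>, \<open>M P\<close> is the least
    \<open>e \<ge> 0\<close> for which the cube of side \<open>e\<close> at \<open>a\<close> meets
    \<open>P\<close>.\<close>
  define M where "M P = Max (range (\<lambda>i. lo P i - a i))" for P
  have M_ge: "lo P i - a i \<le> M P" for P i by (simp add: M_def)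
  have M_le: "M P \<le> c" if "\<And>i. lo P i - a i \<le> c" for P c
    using that unfolding M_def by (subst Max_le_iff) auto
  \<comment> \<open>The values of \<open>e\<close> charged to \<open>P\<close>, always
    \<open>side P\<close> many. If \<open>P\<close> has corner \<open>a\<close>, then
    \<open>M P = 0\<close> and the window must be 1 to \<open>side P\<close>, to include the case
    that the cube of side \<open>e\<close> equals \<open>P\<close>; hence the \<open>max\<close>
    with 1.\<close>
  define J where "J P = {max (M P) 1 .. max (M P) 1 + side P - 1}" for P

  have cover: "{1..s - 1} \<subseteq> (\<Union>P\<in>T. J P)"
  proof
    fix e assume e: "e \<in> {1..s - 1}"
    let ?R = "cube a e"
    have RQ: "?R \<subset> ?Q"
      using e by (auto simp: psubset_eq cube_subset_iff set_eq_subset)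
    have "\<exists>P\<in>T. e \<in> J P"
    proof (cases "?R \<in> H")
      case True
      then obtain P where P: "P \<in> T" "?R \<subseteq> P" using top[of ?R] RQ D_def by blast
      have "lo P i \<le> a i \<and> a i + e \<le> lo P i + side P" for i
        using P(2) cube[OF T_H[OF P(1)]] cube_subset_iff[of e a "lo P" "side P"] e by simp
      \<comment> \<open>Lying between \<open>?R\<close> and \<open>?Q\<close>, which share the
        corner \<open>a\<close>, \<open>P\<close> has this corner too.\<close>
      moreover have "a i \<le> lo P i" for i
        using subset_iff[OF T_H[OF P(1)], of a s] T_Q[OF P(1)] by blast
      ultimately have "lo P i = a i \<and> e \<le> side P" for i
        by (smt (verit))
      then have "e \<in> J P" using e by (simp add: J_def M_def)
      then show ?thesis using P by blast
    next
      case False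
      have "?R \<in> cubic_bricks m"
        unfolding cubic_bricks_def using e Q_bounds
        by (intro CollectI exI[of _ a] exI[of _ e]) (smt (verit) atLeastAtMost_iff)
      then obtain X where X: "X \<in> H" "\<not> compatible X ?R" using max False by blast
      \<comment> \<open>\<open>X\<close> meets \<open>?R\<close> and hence \<open>?Q\<close>, but
        cannot contain \<open>?Q\<close>, since it would then contain \<open>?R\<close>.\<close>
      then have "X \<in> D"
        using sys(2)[OF X(1) less.prems(1)] RQ by (auto simp: D_def compatible_def)
      then obtain P where P: "P \<in> T" "X \<subseteq> P" using top by blast
      have PH: "P \<in> H" using P T_H by blast
      have X_P: "lo P i \<le> lo X i \<and> lo X i + side X \<le> lo P i + side P" for i
        using subset_iff[OF X(1), of "lo P" "side P"] cube[OF PH] P(2) by auto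
      have X_Q: "a i \<le> lo X i" for i
        using subset_iff[OF X(1), of a s] \<open>X \<in> D\<close> by (auto simp: D_def)
      have "P \<inter> ?R \<noteq> {}" using X(2) P(2) by (auto simp: compatible_def)
      then have "lo P i - a i \<le> e" for i
        using cube_disjoint_iff[of "side P" e "lo P" a] cube[OF PH] side[OF PH] e
        by (smt (verit) atLeastAtMost_iff)
      then have "M P \<le> e" by (rule M_le)
      \<comment> \<open>\<open>X\<close> is not inside \<open>?R\<close> but lies above the corner
        \<open>a\<close>, so it exceeds \<open>?R\<close> at some upper face, and so does
        \<open>P\<close>.\<close>
      moreover obtain i where "a i + e < lo X i + side X"
        using X subset_iff[OF X(1), of a e] X_Q by (auto simp: compatible_def not_le)
      then have "e < M P + side P" using X_P[of i] M_ge[of P i] by linarith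
      ultimately have "e \<in> J P" using e by (auto simp: J_def)
      then show ?thesis using P by blast
    qed
    then show "e \<in> (\<Union>P\<in>T. J P)" by blast
  qed

  have IH: "side P \<le> int (card {X \<in> H. X \<subseteq> P})" if "P \<in> T" for P
  proof -
    have P: "P = cube (lo P) (side P)" "0 < side P" "P \<in> H"
      using T_H[OF that] cube side by blast+
    have "side P < s"
      using cube_psubset_side_less[of "lo P" "side P" a s] T_Q[OF that] P by simp
    then show ?thesis
      using less.hyps[of "side P" "lo P"] P by simp
  qed
  have disj: "{X \<in> H. X \<subseteq> P} \<inter> {X \<in> H. X \<subseteq> P'} = {}" if "P \<in> T" "P' \<in> T" "P \<noteq> P'" for P P'
  proof -
    \<comment> \<open>Distinct maximal members of \<open>D\<close> are not nested, so compatibility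
      leaves only disjointness.\<close>
    have "P \<inter> P' = {}"
      using that sys(2)[of P P'] T_H unfolding T_def compatible_def by blast
    then show ?thesis using nonempty by blast
  qed
  have "s - 1 = int (card {1..s - 1})" using less.prems by simp
  also have "\<dots> \<le> int (card (\<Union>P\<in>T. J P))"
    using cover \<open>finite T\<close> by (intro of_nat_mono card_mono) (auto simp: J_def)
  also have "\<dots> \<le> int (\<Sum>P\<in>T. card (J P))"
    by (intro of_nat_mono card_UN_le \<open>finite T\<close>)
  also have "\<dots> = (\<Sum>P\<in>T. side P)"
    unfolding of_nat_sum by (intro sum.cong) (use T_H side in \<open>auto simp: J_def less_imp_le\<close>)
  also have "\<dots> \<le> int (\<Sum>P\<in>T. card {X \<in> H. X \<subseteq> P})"
    unfolding of_nat_sum by (intro sum_mono IH)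
  also have "(\<Sum>P\<in>T. card {X \<in> H. X \<subseteq> P}) = card (\<Union>P\<in>T. {X \<in> H. X \<subseteq> P})"
    using disj \<open>finite T\<close> \<open>finite H\<close> by (intro card_UN_disjoint[symmetric]) auto
  \<comment> \<open>No \<open>P\<close> in \<open>T\<close> contains \<open>?Q\<close>; counting
    \<open>?Q\<close> itself turns the bound \<open>s - 1\<close> into \<open>s\<close>.\<close>
  also have "int \<dots> \<le> int (card ({X \<in> H. X \<subseteq> ?Q} - {?Q}))"
    using T_Q \<open>finite H\<close> by (intro of_nat_mono card_mono) auto
  also have "\<dots> = int (card {X \<in> H. X \<subseteq> ?Q}) - 1"
  proof -
    have "card {X \<in> H. X \<subseteq> ?Q} = Suc (card ({X \<in> H. X \<subseteq> ?Q} - {?Q}))"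
      using less.prems \<open>finite H\<close> by (intro card.remove) auto
    then show ?thesis by simp
  qed
  finally show ?case by simp
qed

text \<open>The full cube contains every member, so maximality puts it into \<open>H\<close>, and
  the members below it are all of \<open>H\<close>.\<close>

lemma card_maximal_ge:
  fixes H :: "(real ^ 'd) set set"
  assumes H: "H \<in> maximal_cubic_island_systems m" and "m > 0"
  shows "m \<le> card H"
proof -
  let ?C = "cube (\<lambda>_. 0) (int m) :: (real ^ 'd) set"
  have sub: "X \<subseteq> ?C" if "X \<in> H" for X
  proof -
    have "X \<in> cubic_bricks m"
      using that H unfolding maximal_cubic_island_systems_iff cubic_island_systems_iff by blast
    then obtain a s where "X = cube a s" "0 < s" "\<forall>i. 0 \<le> a i \<and> a i + s \<le> int m"
      unfolding cubic_bricks_def by blast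
    then show ?thesis by (simp add: cube_subset_iff)
  qed
  have "?C \<in> cubic_bricks m"
    unfolding cubic_bricks_def using \<open>m > 0\<close> by force
  then have "?C \<in> H"
    using sub H unfolding maximal_cubic_island_systems_iff compatible_def by blast
  then have "int m \<le> int (card {X \<in> H. X \<subseteq> ?C})"
    using side_le_card_below[OF H, of "\<lambda>_. 0" "int m"] \<open>m > 0\<close> by simp
  also have "{X \<in> H. X \<subseteq> ?C} = H" using sub by blast
  finally show ?thesis by simp
qed

theorem theorem2:
  fixes m :: nat
  assumes "m > 0"
  shows "min_maximal_cubic TYPE('d::finite) m = m"
  unfolding min_maximal_cubic_def
proof (rule Min_eqI)
  show "finite (card ` (maximal_cubic_island_systems m :: (real ^ 'd) set set set))"
    by (intro finite_imageI finite_maximal_cubic_island_systems)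
next
  fix n assume "n \<in> card ` (maximal_cubic_island_systems m :: (real ^ 'd) set set set)"
  then show "m \<le> n" using card_maximal_ge assms by blast
next
  show "m \<in> card ` (maximal_cubic_island_systems m :: (real ^ 'd) set set set)"
    using cube_chain_maximal[where 'd = 'd] card_cube_chain[where 'd = 'd and m = m]
    by (metis image_eqI)
qed

end
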